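(* Let $X_1, \dotsc, X_p, y$ be real-valued random variables (on a common probability space) with finite nonzero variance. Then $$\sum_{i=1}^p |\operatorname{corr}(X_i,y)|^2 \ \leq \ \lambda_{\max},$$ where $\lambda_{\max}$ is the maximum eigenvalue of the $p \times p$ correlation matrix $\Sigma$ with entries $\Sigma_{i,j} = \operatorname{corr}(X_i,X_j)$.
   Context: For real-valued random variables $U, V$ with finite nonzero variance, $\operatorname{corr}(U,V) = \dfrac{\mathbb{E}[(U-\mathbb{E}U)(V-\mathbb{E}V)]}{\sqrt{\operatorname{var}(U)\operatorname{var}(V)}}$ denotes the (Pearson) correlation. *)

theory Defs
  imports "HOL-Probability.Probability" "Jordan_Normal_Form.Spectral_Radius"
begin

text \<open>
  Since the Bochner integral of a non-integrable function is 0 by convention, the existence of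
  the mean and of the variance is stated explicitly as integrability.
\<close>

definition finite_nonzero_variance :: "'a measure \<Rightarrow> ('a \<Rightarrow> real) \<Rightarrow> bool" where
  "finite_nonzero_variance M U \<longleftrightarrow>
     prob_space.random_variable M borel U \<and>
     integrable M U \<and>
     integrable M (\<lambda>\<omega>. (U \<omega> - prob_space.expectation M U)\<^sup>2) \<and>
     prob_space.variance M U \<noteq> 0"

definition corr :: "'a measure \<Rightarrow> ('a \<Rightarrow> real) \<Rightarrow> ('a \<Rightarrow> real) \<Rightarrow> real" where
  "corr M U V =
     prob_space.expectation M
       (\<lambda>\<omega>. (U \<omega> - prob_space.expectation M U) * (V \<omega> - prob_space.expectation M V))
     / sqrt (prob_space.variance M U * prob_space.variance M V)"

definition corr_matrix :: "'a measure \<Rightarrow> nat \<Rightarrow> (nat \<Rightarrow> 'a \<Rightarrow> real) \<Rightarrow> real mat" where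
  "corr_matrix M p X = mat p p (\<lambda>(i, j). corr M (X i) (X j))"

text \<open>
  Only real eigenvalues are considered, which for a symmetric matrix are all of them. A
  symmetric real matrix of positive size has a nonempty finite spectrum, so that \<open>Max\<close> is the
  genuine maximum.
\<close>

definition max_eigenvalue :: "real mat \<Rightarrow> real" where
  "max_eigenvalue A = Max (spectrum A)"

end

theory Submission
  imports Defs
begin

text \<open>
  Standardize the variables and put \<open>c\<^sub>i = corr (X\<^sub>i, y)\<close>. The combination \<open>S = \<Sum> c\<^sub>i X\<^sub>i\<close> has
  second moment \<open>c\<^sup>T \<Sigma> c\<close> and \<open>E[S y] = |c|\<^sup>2\<close>, so that \<open>0 \<le> E[(S - |c|\<^sup>2 y)\<^sup>2]\<close> gives
  \<open>|c|\<^sup>4 \<le> c\<^sup>T \<Sigma> c\<close>. The maximum of the Rayleigh quotient is attained, at an eigenvector, whence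
  \<open>c\<^sup>T \<Sigma> c \<le> \<lambda>\<^sub>m\<^sub>a\<^sub>x |c|\<^sup>2\<close>.
\<close>

section \<open>Symmetric quadratic forms and the maximum of the Rayleigh quotient\<close>

text \<open>A zero of a nonnegative form is a minimum, so the gradient vanishes there. Concretely,
  moving from \<open>x\<close> to \<open>x - t w\<close> with \<open>w = c x\<close> changes the
  form by \<open>- 2 t s + t\<^sup>2 K\<close>, where \<open>s\<close> is the squared length of
  \<open>w\<close>; for small positive \<open>t\<close> this would be negative unless
  \<open>w = 0\<close>.\<close>

lemma psd_form_kernel:
  fixes c :: "'i \<Rightarrow> 'i \<Rightarrow> real"
  assumes "finite I" and sym: "\<And>i j. i \<in> I \<Longrightarrow> j \<in> I \<Longrightarrow> c i j = c j i"
    and psd: "\<And>v. 0 \<le> (\<Sum>i\<in>I. \<Sum>j\<in>I. c i j * v i * v j)"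
    and zero: "(\<Sum>i\<in>I. \<Sum>j\<in>I. c i j * x i * x j) = 0"
    and "i \<in> I"
  shows "(\<Sum>j\<in>I. c i j * x j) = 0"
proof -
  define w where "w i = (\<Sum>j\<in>I. c i j * x j)" for i
  define s where "s = (\<Sum>i\<in>I. (w i)\<^sup>2)"
  define K where "K = (\<Sum>i\<in>I. \<Sum>j\<in>I. c i j * w i * w j)"
  have wx: "(\<Sum>i\<in>I. \<Sum>j\<in>I. c i j * w i * x j) = s"
  proof -
    have "(\<Sum>j\<in>I. c i j * w i * x j) = w i * w i" for i
      by (subst (3) w_def) (simp add: sum_distrib_left mult_ac)
    thus ?thesis by (simp add: s_def power2_eq_square)
  qed
  \<comment> \<open>Symmetry enters here: it makes the two cross terms equal.\<close>
  have xw: "(\<Sum>i\<in>I. \<Sum>j\<in>I. c i j * x i * w j) = s"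
    unfolding wx[symmetric] by (subst sum.swap) (auto intro!: sum.cong simp: sym)
  have "K \<ge> 0" unfolding K_def by (rule psd)
  \<comment> \<open>The vertex of the parabola is at \<open>s / K\<close>; the denominator
    \<open>K + 1\<close> also covers \<open>K = 0\<close> and still gives the negative value
    \<open>- (t\<^sup>2 * (K + 2))\<close> when \<open>t\<close> is nonzero.\<close>
  define t where "t = s / (K + 1)"
  have s: "s = t * (K + 1)" using \<open>K \<ge> 0\<close> by (simp add: t_def)
  have "0 \<le> (\<Sum>i\<in>I. \<Sum>j\<in>I. c i j * (x i - t * w i) * (x j - t * w j))"
    by (rule psd)
  also have "\<dots> = (\<Sum>i\<in>I. \<Sum>j\<in>I. c i j * x i * x j - t * (c i j * x i * w j)
      - t * (c i j * w i * x j) + t\<^sup>2 * (c i j * w i * w j))"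
    by (intro sum.cong refl) (simp add: algebra_simps power2_eq_square)
  also have "\<dots> = - 2 * t * s + t\<^sup>2 * K"
    by (simp add: sum.distrib sum_subtractf zero xw wx K_def flip: sum_distrib_left)
  also have "\<dots> = - (t\<^sup>2 * (K + 2))"
    by (simp add: s power2_eq_square algebra_simps)
  finally have "t\<^sup>2 * (K + 2) \<le> 0" by simp
  hence "t = 0" using \<open>K \<ge> 0\<close> by (auto simp: mult_le_0_iff)
  hence "s = 0" using s by simp
  thus ?thesis
    using \<open>finite I\<close> \<open>i \<in> I\<close> unfolding s_def w_def[symmetric] by (simp add: sum_nonneg_eq_0_iff)
qed

text \<open>Vectors are functions on the whole index type, so the coordinates outside
  \<open>I\<close> are pinned to 0 to keep the sphere bounded. It is then a closed subset of a
  product of intervals and singletons, which is compact by Tychonoff.\<close>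

lemma compact_coordinate_sphere:
  assumes "finite (I :: 'i set)"
  shows "compact {x :: 'i \<Rightarrow> real. (\<forall>i. i \<notin> I \<longrightarrow> x i = 0) \<and> (\<Sum>i\<in>I. (x i)\<^sup>2) = 1}" (is "compact ?K")
proof -
  let ?P = "PiE UNIV (\<lambda>i. if i \<in> I then {-1..1::real} else {0})"
  have "compactin (product_topology (\<lambda>_. euclidean) UNIV) ?P"
    by (subst compactin_PiE) auto
  hence "compact ?P" by (simp add: euclidean_product_topology)
  moreover have "closed {x :: 'i \<Rightarrow> real. (\<Sum>i\<in>I. (x i)\<^sup>2) = 1}"
    by (intro closed_Collect_eq continuous_intros continuous_on_product_coordinates)
  ultimately have "compact (?P \<inter> {x. (\<Sum>i\<in>I. (x i)\<^sup>2) = 1})"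
    by (rule compact_Int_closed)
  also have "?P \<inter> {x. (\<Sum>i\<in>I. (x i)\<^sup>2) = 1} = ?K"
  proof -
    have "x i \<in> {-1..1}" if "(\<Sum>i\<in>I. (x i)\<^sup>2) = 1" "i \<in> I" for x :: "'i \<Rightarrow> real" and i
    proof -
      have "(x i)\<^sup>2 \<le> 1"
        using member_le_sum[of i I "\<lambda>i. (x i)\<^sup>2"] that assms by simp
      thus ?thesis by (simp add: abs_square_le_1 abs_le_iff)
    qed
    thus ?thesis by (auto simp: PiE_iff split: if_splits)
  qed
  finally show ?thesis .
qed

text \<open>By compactness the form \<open>Q\<close> attains its maximum \<open>m\<close> over the
  unit sphere at some \<open>x\<close>. Then \<open>m |v|\<^sup>2 - Q v\<close> is a nonnegative
  form that vanishes at \<open>x\<close>, and \<open>psd_form_kernel\<close> turns this into the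
  eigenvector equation.\<close>

lemma symmetric_form_bounded_by_eigenvalue:
  fixes a :: "'i \<Rightarrow> 'i \<Rightarrow> real"
  assumes fin: "finite I" and "I \<noteq> {}" and sym: "\<And>i j. i \<in> I \<Longrightarrow> j \<in> I \<Longrightarrow> a i j = a j i"
  obtains m x where "\<exists>i\<in>I. x i \<noteq> 0" "\<And>i. i \<in> I \<Longrightarrow> (\<Sum>j\<in>I. a i j * x j) = m * x i"
    "\<And>v. (\<Sum>i\<in>I. \<Sum>j\<in>I. a i j * v i * v j) \<le> m * (\<Sum>i\<in>I. (v i)\<^sup>2)"
proof -
  define Q where "Q v = (\<Sum>i\<in>I. \<Sum>j\<in>I. a i j * v i * v j)" for v
  define K where "K = {x :: 'i \<Rightarrow> real. (\<forall>i. i \<notin> I \<longrightarrow> x i = 0) \<and> (\<Sum>i\<in>I. (x i)\<^sup>2) = 1}"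
  obtain k where "k \<in> I" using \<open>I \<noteq> {}\<close> by auto
  hence "(\<lambda>i. of_bool (i = k)) \<in> K"
    using fin by (auto simp: K_def power2_eq_square simp flip: of_bool_conj)
  hence "K \<noteq> {}" by blast
  moreover have "continuous_on K Q"
    unfolding Q_def
    by (intro continuous_intros continuous_on_subset[OF continuous_on_product_coordinates]) auto
  ultimately obtain x where x: "x \<in> K" and max: "\<And>v. v \<in> K \<Longrightarrow> Q v \<le> Q x"
    using continuous_attains_sup[of K Q] compact_coordinate_sphere[OF fin]
    unfolding K_def[symmetric] by blast
  \<comment> \<open>\<open>Q\<close> is homogeneous of degree 2, so a vector that is nonzero on
    \<open>I\<close> can be rescaled to the sphere.\<close>
  have le: "Q v \<le> Q x * (\<Sum>i\<in>I. (v i)\<^sup>2)" for v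
  proof (cases "(\<Sum>i\<in>I. (v i)\<^sup>2) = 0")
    case True
    hence "\<forall>i\<in>I. v i = 0" using fin by (simp add: sum_nonneg_eq_0_iff)
    thus ?thesis by (simp add: Q_def)
  next
    case False
    define r where "r = (\<Sum>i\<in>I. (v i)\<^sup>2)"
    have "r > 0" using False sum_nonneg[of I "\<lambda>i. (v i)\<^sup>2"] by (simp add: r_def less_le)
    define u where "u i = (if i \<in> I then v i / sqrt r else 0)" for i
    have "(\<Sum>i\<in>I. (u i)\<^sup>2) = (\<Sum>i\<in>I. (v i)\<^sup>2 / r)"
      using \<open>r > 0\<close> by (intro sum.cong) (auto simp: u_def power_divide)
    also have "\<dots> = 1" using \<open>r > 0\<close> by (simp add: r_def flip: sum_divide_distrib)
    finally have "Q u \<le> Q x" by (intro max) (simp add: K_def u_def)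
    also have "Q u = (\<Sum>i\<in>I. \<Sum>j\<in>I. a i j * v i * v j / r)"
      unfolding Q_def using \<open>r > 0\<close> by (intro sum.cong refl) (simp add: u_def)
    also have "\<dots> = Q v / r" by (simp add: Q_def flip: sum_divide_distrib)
    finally show ?thesis using \<open>r > 0\<close> by (simp add: r_def[symmetric] field_simps)
  qed
  \<comment> \<open>The matrix \<open>m 1 - a\<close> with \<open>m = Q x\<close>: its form is
    nonnegative by \<open>le\<close> and zero at \<open>x\<close>, which has unit length.\<close>
  define c where "c i j = (if i = j then Q x else 0) - a i j" for i j
  have row: "(\<Sum>j\<in>I. c i j * v j) = Q x * v i - (\<Sum>j\<in>I. a i j * v j)" if "i \<in> I" for i v
  proof -
    have "(\<Sum>j\<in>I. c i j * v j) = (\<Sum>j\<in>I. (if i = j then Q x * v j else 0) - a i j * v j)"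
      by (intro sum.cong) (auto simp: c_def algebra_simps)
    thus ?thesis using fin that by (simp add: sum_subtractf)
  qed
  have form: "(\<Sum>i\<in>I. \<Sum>j\<in>I. c i j * v i * v j) = Q x * (\<Sum>i\<in>I. (v i)\<^sup>2) - Q v" for v
  proof -
    have "(\<Sum>i\<in>I. \<Sum>j\<in>I. c i j * v i * v j) = (\<Sum>i\<in>I. v i * (\<Sum>j\<in>I. c i j * v j))"
      by (simp add: sum_distrib_left mult_ac)
    also have "\<dots> = (\<Sum>i\<in>I. Q x * (v i)\<^sup>2 - (\<Sum>j\<in>I. a i j * v i * v j))"
      by (intro sum.cong refl)
        (simp only: row, simp add: right_diff_distrib power2_eq_square sum_distrib_left mult_ac)
    finally show ?thesis by (simp add: sum_subtractf sum_distrib_left Q_def)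
  qed
  show thesis
  proof
    show "\<exists>i\<in>I. x i \<noteq> 0" using x by (auto simp: K_def intro: ccontr)
    show "(\<Sum>j\<in>I. a i j * x j) = Q x * x i" if "i \<in> I" for i
    proof -
      have "(\<Sum>j\<in>I. c i j * x j) = 0"
        by (rule psd_form_kernel[OF fin _ _ _ that])
          (use x le in \<open>auto simp: K_def form, auto simp: c_def sym\<close>)
      thus ?thesis using row[OF that] by simp
    qed
    show "(\<Sum>i\<in>I. \<Sum>j\<in>I. a i j * v i * v j) \<le> Q x * (\<Sum>i\<in>I. (v i)\<^sup>2)" for v
      using le[of v] by (simp add: Q_def)
  qed
qed

text \<open>The maximum \<open>m\<close> of the Rayleigh quotient is an eigenvalue, hence at most
  the \<open>Max\<close> of the finite spectrum; replacing \<open>m\<close> by that larger factor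
  preserves the bound because the sum of squares is nonnegative.\<close>

lemma symmetric_form_le_max_eigenvalue:
  fixes A :: "real mat"
  assumes A: "A \<in> carrier_mat n n" and "n > 0"
    and sym: "\<And>i j. i < n \<Longrightarrow> j < n \<Longrightarrow> A $$ (i, j) = A $$ (j, i)"
  shows "(\<Sum>i<n. \<Sum>j<n. A $$ (i, j) * v i * v j) \<le> max_eigenvalue A * (\<Sum>i<n. (v i)\<^sup>2)"
proof (rule symmetric_form_bounded_by_eigenvalue[of "{..<n}" "\<lambda>i j. A $$ (i, j)"])
  show "{..<n} \<noteq> {}" using \<open>n > 0\<close> by auto
  show "A $$ (i, j) = A $$ (j, i)" if "i \<in> {..<n}" "j \<in> {..<n}" for i j
    using that sym by simp
  fix m x
  assume nz: "\<exists>i\<in>{..<n}. x i \<noteq> 0"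
    and eig: "\<And>i. i \<in> {..<n} \<Longrightarrow> (\<Sum>j<n. A $$ (i, j) * x j) = m * x i"
    and le: "\<And>v. (\<Sum>i<n. \<Sum>j<n. A $$ (i, j) * v i * v j) \<le> m * (\<Sum>i<n. (v i)\<^sup>2)"
  have "eigenvector A (vec n x) m"
    unfolding eigenvector_def
  proof (intro conjI)
    show "vec n x \<in> carrier_vec (dim_row A)" using A by auto
    show "vec n x \<noteq> 0\<^sub>v (dim_row A)"
      using nz A by (auto simp: vec_eq_iff)
    show "A *\<^sub>v vec n x = m \<cdot>\<^sub>v vec n x"
      using A eig by (intro eq_vecI) (auto simp: scalar_prod_def atLeast0LessThan)
  qed
  hence "m \<in> spectrum A" by (auto simp: spectrum_def eigenvalue_def)
  hence "m \<le> max_eigenvalue A"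
    unfolding max_eigenvalue_def using card_finite_spectrum(1)[OF A] by (rule Max_ge[rotated])
  hence "m * (\<Sum>i<n. (v i)\<^sup>2) \<le> max_eigenvalue A * (\<Sum>i<n. (v i)\<^sup>2)"
    by (intro mult_right_mono sum_nonneg) auto
  with le[of v] show ?thesis by linarith
qed simp

section \<open>Correlations as inner products of standardized variables\<close>

text \<open>By \<open>2 |f| |g| \<le> f\<^sup>2 + g\<^sup>2\<close> the product is dominated by an
  integrable function.\<close>

lemma integrable_mult_of_squares:
  fixes f g :: "'a \<Rightarrow> real"
  assumes [measurable]: "f \<in> borel_measurable M" "g \<in> borel_measurable M"
    and "integrable M (\<lambda>x. (f x)\<^sup>2)" "integrable M (\<lambda>x. (g x)\<^sup>2)"
  shows "integrable M (\<lambda>x. f x * g x)"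
proof (rule Bochner_Integration.integrable_bound)
  show "integrable M (\<lambda>x. (f x)\<^sup>2 + (g x)\<^sup>2)" using assms by simp
  have "\<bar>f x * g x\<bar> \<le> (f x)\<^sup>2 + (g x)\<^sup>2" for x
    using sum_squares_bound[of "\<bar>f x\<bar>" "\<bar>g x\<bar>"] mult_nonneg_nonneg[of "\<bar>f x\<bar>" "\<bar>g x\<bar>"]
    unfolding abs_mult power2_abs by linarith
  thus "AE x in M. norm (f x * g x) \<le> norm ((f x)\<^sup>2 + (g x)\<^sup>2)" by simp
qed simp

text \<open>For variables of finite nonzero variance this makes correlations inner products of unit
  vectors in L2, and the correlation matrix a Gram matrix.\<close>

definition standardized :: "'a measure \<Rightarrow> ('a \<Rightarrow> real) \<Rightarrow> 'a \<Rightarrow> real" where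
  "standardized M U \<omega> =
     (U \<omega> - prob_space.expectation M U) / sqrt (prob_space.variance M U)"

context prob_space
begin

lemma corr_eq_expectation_standardized:
  "corr M U V = expectation (\<lambda>\<omega>. standardized M U \<omega> * standardized M V \<omega>)"
  by (simp add: corr_def standardized_def real_sqrt_mult)

lemma corr_commute: "corr M U V = corr M V U"
  by (simp add: corr_def mult.commute)

lemma corr_self:
  assumes "finite_nonzero_variance M U"
  shows "corr M U U = 1"
  using assms by (simp add: corr_def finite_nonzero_variance_def power2_eq_square)

text \<open>Integrability and value are packed together so that the expectation of an expanded
  square can be computed term by term.\<close>

lemma has_bochner_integral_corr:
  assumes "finite_nonzero_variance M U" "finite_nonzero_variance M V"
  shows "has_bochner_integral M (\<lambda>\<omega>. standardized M U \<omega> * standardized M V \<omega>) (corr M U V)"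
  unfolding corr_eq_expectation_standardized
proof (rule has_bochner_integral_integrable, rule integrable_mult_of_squares)
  have "standardized M W \<in> borel_measurable M" "integrable M (\<lambda>\<omega>. (standardized M W \<omega>)\<^sup>2)"
    if "finite_nonzero_variance M W" for W
    using that unfolding finite_nonzero_variance_def standardized_def[abs_def]
    by (auto simp: power_divide)
  thus "standardized M U \<in> borel_measurable M" "standardized M V \<in> borel_measurable M"
    "integrable M (\<lambda>\<omega>. (standardized M U \<omega>)\<^sup>2)" "integrable M (\<lambda>\<omega>. (standardized M V \<omega>)\<^sup>2)"
    using assms by auto
qed

text \<open>This is Cauchy-Schwarz in L2 for \<open>S = \<Sum> c i * ?Z i\<close> and the unit
  vector \<open>?W\<close>: the left side is the square of \<open>E[S ?W]\<close>, the right side is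
  \<open>E[S\<^sup>2]\<close>.\<close>

lemma sum_corr_squares_le_corr_form:
  assumes X: "\<And>i. i < p \<Longrightarrow> finite_nonzero_variance M (X i)"
    and y: "finite_nonzero_variance M y"
  shows "(\<Sum>i<p. (corr M (X i) y)\<^sup>2)\<^sup>2
    \<le> (\<Sum>i<p. \<Sum>j<p. corr M (X i) (X j) * corr M (X i) y * corr M (X j) y)"
proof -
  define c where "c i = corr M (X i) y" for i
  \<comment> \<open>\<open>t\<close> equals \<open>E[S ?W]\<close>, so \<open>t * ?W\<close> is the
    orthogonal projection of \<open>S\<close> onto \<open>?W\<close>, the multiple for which
    nonnegativity of the squared distance says most.\<close>
  define t where "t = (\<Sum>i<p. (c i)\<^sup>2)"
  let ?Z = "\<lambda>i. standardized M (X i)" and ?W = "standardized M y"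
  have "0 \<le> expectation (\<lambda>\<omega>. ((\<Sum>i<p. c i * ?Z i \<omega>) - t * ?W \<omega>)\<^sup>2)"
    by simp
  \<comment> \<open>The square is expanded into products of two standardized variables,
    \<open>?W \<omega> * ?W \<omega>\<close> included, so that each term has a correlation as its
    expectation.\<close>
  also have "(\<lambda>\<omega>. ((\<Sum>i<p. c i * ?Z i \<omega>) - t * ?W \<omega>)\<^sup>2) =
    (\<lambda>\<omega>. (\<Sum>i<p. \<Sum>j<p. c i * c j * (?Z i \<omega> * ?Z j \<omega>))
       - 2 * t * (\<Sum>i<p. c i * (?Z i \<omega> * ?W \<omega>)) + t\<^sup>2 * (?W \<omega> * ?W \<omega>))"
    (is "?l = ?r")
  proof
    fix \<omega>
    have "(\<Sum>i<p. c i * ?Z i \<omega>)\<^sup>2 = (\<Sum>i<p. \<Sum>j<p. c i * c j * (?Z i \<omega> * ?Z j \<omega>))"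
      by (simp add: power2_eq_square sum_product mult_ac)
    moreover have "(\<Sum>i<p. c i * ?Z i \<omega>) * ?W \<omega> = (\<Sum>i<p. c i * (?Z i \<omega> * ?W \<omega>))"
      by (simp add: sum_distrib_right mult.assoc)
    ultimately show "?l \<omega> = ?r \<omega>"
      by (simp add: power2_diff power_mult_distrib power2_eq_square[of "?W \<omega>"])
  qed
  also have "expectation \<dots> = (\<Sum>i<p. \<Sum>j<p. c i * c j * corr M (X i) (X j))
      - 2 * t * (\<Sum>i<p. c i * corr M (X i) y) + t\<^sup>2 * corr M y y"
    using X y
    by (intro has_bochner_integral_integral_eq has_bochner_integral_add has_bochner_integral_diff
        has_bochner_integral_sum has_bochner_integral_mult_right has_bochner_integral_corr) auto
  also have "\<dots> = (\<Sum>i<p. \<Sum>j<p. c i * c j * corr M (X i) (X j)) - t\<^sup>2"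
    by (simp add: corr_self[OF y] c_def[symmetric] t_def power2_eq_square)
  finally show ?thesis by (simp add: t_def c_def mult_ac)
qed

end

theorem theorem3:
  fixes M :: "'a measure" and p :: nat
    and X :: "nat \<Rightarrow> 'a \<Rightarrow> real" and y :: "'a \<Rightarrow> real"
  assumes "prob_space M"
    and "p \<ge> 1"
    and "\<And>i. i < p \<Longrightarrow> finite_nonzero_variance M (X i)"
    and "finite_nonzero_variance M y"
  shows "(\<Sum>i<p. \<bar>corr M (X i) y\<bar>\<^sup>2) \<le> max_eigenvalue (corr_matrix M p X)"
proof -
  interpret prob_space M by fact
  let ?A = "corr_matrix M p X" and ?c = "\<lambda>i. corr M (X i) y"
  define s where "s = (\<Sum>i<p. (?c i)\<^sup>2)"
  have form: "(\<Sum>i<p. \<Sum>j<p. corr M (X i) (X j) * v i * v j)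
      \<le> max_eigenvalue ?A * (\<Sum>i<p. (v i)\<^sup>2)" for v
  proof -
    have "(\<Sum>i<p. \<Sum>j<p. ?A $$ (i, j) * v i * v j) \<le> max_eigenvalue ?A * (\<Sum>i<p. (v i)\<^sup>2)"
      using \<open>p \<ge> 1\<close> by (intro symmetric_form_le_max_eigenvalue)
        (auto simp: corr_matrix_def intro: corr_commute)
    thus ?thesis by (simp add: corr_matrix_def)
  qed
  have "s \<ge> 0" by (simp add: s_def sum_nonneg)
  have "s \<le> max_eigenvalue ?A"
  proof (cases "s = 0")
    case True
    \<comment> \<open>Here \<open>s\<close> cannot be cancelled, and nonnegativity of the largest
      eigenvalue is what is left to show. The first coordinate vector picks out a diagonal entry 1
      of the correlation matrix, which bounds that eigenvalue from below.\<close>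
    have "{..<p} = insert 0 {1..<p}" using \<open>p \<ge> 1\<close> by auto
    hence "1 \<le> max_eigenvalue ?A"
      using form[of "\<lambda>i. of_bool (i = 0)"] corr_self[OF assms(3)[of 0]] \<open>p \<ge> 1\<close> by simp
    thus ?thesis using True by simp
  next
    case False
    \<comment> \<open>Both bounds meet in the form evaluated at the vector of correlations
      \<open>?c\<close>; the positive factor \<open>s\<close> is then cancelled.\<close>
    have "s * s \<le> max_eigenvalue ?A * s"
      using sum_corr_squares_le_corr_form[of p X y, OF assms(3,4)] form[of ?c]
      unfolding s_def power2_eq_square by linarith
    thus ?thesis using False \<open>s \<ge> 0\<close> by simp
  qed
  thus ?thesis by (simp add: s_def)
qed

end
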